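(* Let $(X,d)$ be a compact metric space and let $\phi:X\times\mathbb{R}\rightarrow X$ be a continuous flow on $X$. Then there exists a continuous Lyapunov function $h:X\to\mathbb{R}$ for $\phi$ which is strictly decreasing outside the strong chain recurrent set $\mathcal{SCR}_d(\phi)$, that is, $h(\phi_t(x))<h(x)$ for every $x\in X\setminus\mathcal{SCR}_d(\phi)$ and every $t>0$.
   Context: Write $\phi_t(x)=\phi(x,t)$. A continuous function $h:X\to\mathbb{R}$ is a Lyapunov function for $\phi$ if $h(\phi_t(x))\leq h(x)$ for every $t\geq 0$ and every $x\in X$. Given $x,y\in X$, $\varepsilon>0$ and $T>0$, a strong $(\varepsilon,T)$-chain from $x$ to $y$ is a finite sequence $(x_i,t_i)_{i=1,\dots,n}\subset X\times\mathbb{R}$ such that $t_i\geq T$ for all $i$, $x_1=x$ and, setting $x_{n+1}=y$, $\sum_{i=1}^n d(\phi_{t_i}(x_i),x_{i+1})<\varepsilon$. A point $x\in X$ is strong chain recurrent if for every $\varepsilon>0$ and every $T>0$ there exists a strong $(\varepsilon,T)$-chain from $x$ to $x$. The set of strong chain recurrent points is denoted by $\mathcal{SCR}_d(\phi)$. *)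

theory Defs
  imports "HOL-Analysis.Analysis"
begin

text \<open>
  The compact metric space is a compact set \<open>X\<close> in a type of class \<open>metric_space\<close> (possibly all
  of it), with the metric \<open>dist\<close>. A flow is a map defined on the product of \<open>X\<close> and the reals;
  its values outside this product are irrelevant and never used. We write \<open>\<phi> (x, t)\<close> for the image
  of \<open>x\<close> under the time-\<open>t\<close> map.
\<close>

definition continuous_flow :: "'a::metric_space set \<Rightarrow> ('a \<times> real \<Rightarrow> 'a) \<Rightarrow> bool" where
  "continuous_flow X \<phi> \<longleftrightarrow>
     continuous_on (X \<times> UNIV) \<phi> \<and>
     (\<forall>x\<in>X. \<forall>t. \<phi> (x, t) \<in> X) \<and>
     (\<forall>x\<in>X. \<phi> (x, 0) = x) \<and>
     (\<forall>x\<in>X. \<forall>s t. \<phi> (\<phi> (x, s), t) = \<phi> (x, s + t))"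

definition lyapunov_function ::
  "'a::metric_space set \<Rightarrow> ('a \<times> real \<Rightarrow> 'a) \<Rightarrow> ('a \<Rightarrow> real) \<Rightarrow> bool" where
  "lyapunov_function X \<phi> h \<longleftrightarrow>
     continuous_on X h \<and> (\<forall>x\<in>X. \<forall>t\<ge>0. h (\<phi> (x, t)) \<le> h x)"

text \<open>
  The sequence \<open>(xs i, ts i)\<close> is indexed by \<open>i = 1, \<dots>, n\<close> with \<open>n \<ge> 1\<close>; the endpoint \<open>y\<close> is
  stored as \<open>xs (n + 1)\<close>. Values of \<open>xs\<close> and \<open>ts\<close> at other indices play no role.
\<close>

definition is_strong_chain ::
  "'a::metric_space set \<Rightarrow> ('a \<times> real \<Rightarrow> 'a) \<Rightarrow> real \<Rightarrow> real \<Rightarrow> 'a \<Rightarrow> 'a \<Rightarrow>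
   nat \<Rightarrow> (nat \<Rightarrow> 'a) \<Rightarrow> (nat \<Rightarrow> real) \<Rightarrow> bool" where
  "is_strong_chain X \<phi> \<epsilon> T x y n xs ts \<longleftrightarrow>
     1 \<le> n \<and>
     (\<forall>i\<in>{1..n}. xs i \<in> X \<and> T \<le> ts i) \<and>
     xs 1 = x \<and> xs (n + 1) = y \<and>
     (\<Sum>i=1..n. dist (\<phi> (xs i, ts i)) (xs (i + 1))) < \<epsilon>"

definition strong_chain_recurrent_set ::
  "'a::metric_space set \<Rightarrow> ('a \<times> real \<Rightarrow> 'a) \<Rightarrow> 'a set" where
  "strong_chain_recurrent_set X \<phi> =
     {x \<in> X. \<forall>\<epsilon>>0. \<forall>T>0. \<exists>n xs ts. is_strong_chain X \<phi> \<epsilon> T x x n xs ts}"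

end

theory Submission
  imports Defs
begin

text \<open>
  Let \<open>L y\<close> be the infimum of the \<open>\<epsilon>\<close> for which there is a strong \<open>(\<epsilon>, T)\<close>-chain from \<open>x\<close> to \<open>y\<close>.
  It is 1-Lipschitz in \<open>y\<close> and does not increase under the flow for times at least \<open>T\<close>, so
  \<open>y \<mapsto> sup {L (\<phi> (y, s)) | 0 \<le> s \<le> T}\<close> is a continuous Lyapunov function. If \<open>x\<close> is not strong
  chain recurrent, then \<open>L x > 0\<close> for a suitable \<open>T\<close>, while \<open>L\<close> vanishes on the orbit of \<open>x\<close>
  from time \<open>T\<close> on; hence this function drops somewhere along the orbit of \<open>x\<close> between the times
  \<open>0\<close> and \<open>T\<close>. For a given \<open>t > 0\<close>, composing it with the flow at a suitable time makes the drop
  occur between \<open>x\<close> and \<open>\<phi> (x, t)\<close>. For fixed \<open>t\<close> strictness is an open condition on \<open>x\<close>, so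
  countably many such functions suffice for all points, and it is enough to treat \<open>t = 1 / Suc n\<close>;
  a weighted sum of all these functions is strict everywhere off the recurrent set.
\<close>

section \<open>Countable subcovers of relatively open families\<close>

text \<open>A Lindelof argument: total boundedness gives a finite net at each scale
  \<open>r n\<close>, every point of \<open>U i\<close> lies in a small net ball that fits inside
  \<open>U i\<close>, and one index is chosen for each of the countably many balls that fit
  somewhere.\<close>

lemma compact_countable_subcover:
  fixes X :: "'a::metric_space set"
  assumes "compact X" and op: "\<And>i. i \<in> I \<Longrightarrow> openin (top_of_set X) (U i)"
  obtains J where "J \<subseteq> I" "countable J" "(\<Union>i\<in>J. U i) = (\<Union>i\<in>I. U i)"
proof -
  define r where "r n = 1 / real (Suc n)" for n
  have "0 < r n" for n by (simp add: r_def)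
  then have "\<forall>n. \<exists>K. finite K \<and> X \<subseteq> (\<Union>z\<in>K. ball z (r n))"
    using \<open>compact X\<close> unfolding compact_eq_totally_bounded by blast
  from choice[OF this] obtain K where fin: "\<And>n. finite (K n)"
    and cov: "\<And>n. X \<subseteq> (\<Union>z\<in>K n. ball z (r n))"
    by blast
  define B where "B = {(n, z). z \<in> K n \<and> (\<exists>i\<in>I. ball z (r n) \<inter> X \<subseteq> U i)}"
  define c where "c b = (SOME i. i \<in> I \<and> ball (snd b) (r (fst b)) \<inter> X \<subseteq> U i)" for b
  have c: "c (n, z) \<in> I \<and> ball z (r n) \<inter> X \<subseteq> U (c (n, z))" if "(n, z) \<in> B" for n z
  proof -
    have "\<exists>i. i \<in> I \<and> ball z (r n) \<inter> X \<subseteq> U i"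
      using that by (auto simp only: B_def)
    then show ?thesis unfolding c_def fst_conv snd_conv by (rule someI_ex)
  qed
  have "B \<subseteq> Sigma UNIV K" by (auto simp only: B_def)
  moreover have "countable (Sigma UNIV K)"
    using fin by (intro countable_SIGMA) (simp_all add: countable_finite)
  ultimately have cB: "countable B"
    by (rule countable_subset)
  have "x \<in> (\<Union>i\<in>c ` B. U i)" if i: "i \<in> I" and x: "x \<in> U i" for i x
  proof -
    obtain e where "e > 0" and e: "ball x e \<inter> X \<subseteq> U i" and "x \<in> X"
      using op[OF i] x unfolding openin_contains_ball by blast
    \<comment> \<open>The net point \<open>z\<close> will be within \<open>r n\<close> of
      \<open>x\<close>, so its ball stays within \<open>2 * r n < e\<close> of
      \<open>x\<close>.\<close>
    obtain n where n: "r n < e / 2"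
      unfolding r_def using \<open>e > 0\<close> by (meson half_gt_zero nat_approx_posE)
    obtain z where z: "z \<in> K n" "dist z x < r n"
      using cov[of n] \<open>x \<in> X\<close> by (auto simp only: mem_ball)
    have "dist x w < e" if "dist z w < r n" for w
      using z(2) n that dist_triangle[of x w z] by (simp add: dist_commute)
    then have "ball z (r n) \<inter> X \<subseteq> U i"
      using e by (auto simp only: mem_ball)
    then have nz: "(n, z) \<in> B"
      using z(1) i unfolding B_def by blast
    moreover have "x \<in> U (c (n, z))"
      using c[OF nz] z(2) \<open>x \<in> X\<close> by (auto simp only: mem_ball)
    ultimately show ?thesis by blast
  qed
  then have "(\<Union>i\<in>I. U i) \<subseteq> (\<Union>i\<in>c ` B. U i)"
    by blast
  moreover have cI: "c ` B \<subseteq> I" using c by auto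
  ultimately have "(\<Union>i\<in>c ` B. U i) = (\<Union>i\<in>I. U i)"
    by blast
  then show thesis using that[OF cI] cB by simp
qed

section \<open>Operations on Lyapunov functions\<close>

lemma continuous_on_flow_time:
  assumes "continuous_flow X \<phi>"
  shows "continuous_on X (\<lambda>y. \<phi> (y, t))"
proof -
  have "continuous_on (X \<times> UNIV) \<phi>" using assms by (simp add: continuous_flow_def)
  then show ?thesis
    by (rule continuous_on_compose2) (auto intro!: continuous_intros)
qed

text \<open>Time maps commute, so precomposing with one keeps the decrease along orbits. This
  carries a drop found later on an orbit back to its starting point.\<close>

lemma lyapunov_function_shift:
  assumes "continuous_flow X \<phi>" and "lyapunov_function X \<phi> h"
  shows "lyapunov_function X \<phi> (\<lambda>y. h (\<phi> (y, s)))"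
proof -
  have inX: "\<phi> (x, t) \<in> X" and swap: "\<phi> (\<phi> (x, t), s) = \<phi> (\<phi> (x, s), t)" if "x \<in> X" for x t
    using assms(1) that by (simp_all add: continuous_flow_def add.commute)
  have cont: "continuous_on X h" and le: "\<And>x t. x \<in> X \<Longrightarrow> 0 \<le> t \<Longrightarrow> h (\<phi> (x, t)) \<le> h x"
    using assms(2) by (simp_all add: lyapunov_function_def)
  have "continuous_on X (\<lambda>y. h (\<phi> (y, s)))"
    by (rule continuous_on_compose2[OF cont continuous_on_flow_time[OF assms(1)]])
      (use inX in blast)
  then show ?thesis
    unfolding lyapunov_function_def using le inX swap by simp
qed

text \<open>Every term of a positively weighted series is nonincreasing along orbits, so a strict
  drop of a single \<open>g i\<close> cannot be cancelled in the sum.\<close>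

lemma lyapunov_function_combine:
  assumes "compact X" and flow: "continuous_flow X \<phi>"
    and ly: "\<And>i::nat. lyapunov_function X \<phi> (g i)"
  obtains h where "lyapunov_function X \<phi> h"
    and "\<And>x t. \<lbrakk>x \<in> X; 0 \<le> t; \<exists>i. g i (\<phi> (x, t)) < g i x\<rbrakk> \<Longrightarrow> h (\<phi> (x, t)) < h x"
proof -
  have "\<exists>b>0. \<forall>x\<in>X. \<bar>g i x\<bar> \<le> b" for i
  proof -
    have "bounded (g i ` X)"
      using ly[of i] \<open>compact X\<close>
      by (auto simp: lyapunov_function_def intro: compact_imp_bounded compact_continuous_image)
    then show ?thesis by (auto simp: bounded_pos)
  qed
  then obtain b where b: "\<And>i. b i > 0" "\<And>i x. x \<in> X \<Longrightarrow> \<bar>g i x\<bar> \<le> b i"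
    by metis
  \<comment> \<open>Dividing by the bound \<open>b i\<close> leaves a geometric majorant, as the
    M-test requires for continuity of the sum.\<close>
  define f where "f i x = (1/2) ^ i / b i * g i x" for i x
  have bound: "norm (f i x) \<le> (1/2) ^ i" if "x \<in> X" for i x
    using b(1)[of i] b(2)[OF that, of i] by (simp add: f_def abs_mult field_simps)
  have sumf: "summable (\<lambda>i. f i x)" if "x \<in> X" for x
    by (rule summable_comparison_test'[of "\<lambda>i. (1/2) ^ i :: real"])
      (use bound[OF that] in auto)
  define h where "h x = (\<Sum>i. f i x)" for x
  have inX: "\<phi> (x, t) \<in> X" if "x \<in> X" for x t
    using flow that by (simp add: continuous_flow_def)
  have le: "f i (\<phi> (x, t)) \<le> f i x" if "x \<in> X" "0 \<le> t" for i x t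
    unfolding f_def using ly[of i] that b(1)[of i]
    by (intro mult_left_mono) (auto simp: lyapunov_function_def less_imp_le)
  have "uniform_limit X (\<lambda>n x. \<Sum>i<n. f i x) h sequentially"
    unfolding h_def by (rule Weierstrass_m_test[OF bound]) auto
  moreover have "continuous_on X (\<lambda>x. \<Sum>i<n. f i x)" for n
    using ly unfolding f_def lyapunov_function_def by (intro continuous_intros) auto
  ultimately have "continuous_on X h"
    by (intro uniform_limit_theorem[where F = sequentially]) auto
  then have "lyapunov_function X \<phi> h"
    using le sumf inX unfolding lyapunov_function_def h_def by (auto intro!: suminf_le)
  moreover have "h (\<phi> (x, t)) < h x" if x: "x \<in> X" and t: "0 \<le> t" and ex: "\<exists>i. g i (\<phi> (x, t)) < g i x" for x t
  proof -
    obtain i where "g i (\<phi> (x, t)) < g i x" using ex by blast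
    then have "0 < f i x - f i (\<phi> (x, t))"
      using b(1)[of i] by (simp add: f_def divide_strict_right_mono)
    then have "0 < (\<Sum>i. f i x - f i (\<phi> (x, t)))"
      using le[OF x t] sumf[OF x] sumf[OF inX[OF x]] by (intro suminf_pos2[where i = i]) (auto intro: summable_diff)
    then show ?thesis
      using sumf[OF x] sumf[OF inX[OF x]] by (simp add: h_def suminf_diff[symmetric])
  qed
  ultimately show thesis using that by blast
qed

text \<open>The sets \<open>U a\<close> on which \<open>g a\<close> drops over time \<open>t\<close>
  are open and cover \<open>A\<close>. Since \<open>A\<close> may fail to be compact, a countable
  subfamily is extracted, which a series can absorb.\<close>

lemma lyapunov_function_strict_on:
  assumes "compact X" and flow: "continuous_flow X \<phi>" and "A \<subseteq> X" and "0 \<le> t"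
    and ex: "\<And>x. x \<in> A \<Longrightarrow> \<exists>g. lyapunov_function X \<phi> g \<and> g (\<phi> (x, t)) < g x"
  obtains h where "lyapunov_function X \<phi> h" "\<And>x. x \<in> A \<Longrightarrow> h (\<phi> (x, t)) < h x"
proof -
  obtain g where ly: "\<And>x. x \<in> A \<Longrightarrow> lyapunov_function X \<phi> (g x)"
    and less: "\<And>x. x \<in> A \<Longrightarrow> g x (\<phi> (x, t)) < g x x"
    using ex by metis
  define U where "U a = {x \<in> X. g a (\<phi> (x, t)) < g a x}" for a
  have op: "openin (top_of_set X) (U a)" if "a \<in> A" for a
  proof -
    have "continuous_on X (\<lambda>x. g a x - g a (\<phi> (x, t)))"
      using ly[OF that] lyapunov_function_shift[OF flow ly[OF that]]
      by (auto simp: lyapunov_function_def intro: continuous_intros)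
    moreover have "U a = X \<inter> (\<lambda>x. g a x - g a (\<phi> (x, t))) -` {0<..}"
      by (auto simp: U_def)
    ultimately show ?thesis
      by (metis continuous_openin_preimage_gen open_greaterThan)
  qed
  obtain J where J: "J \<subseteq> A" "countable J" "(\<Union>a\<in>J. U a) = (\<Union>a\<in>A. U a)"
    using compact_countable_subcover[OF \<open>compact X\<close>, of A U, OF op] .
  have "a \<in> U a" if "a \<in> A" for a
    using that less \<open>A \<subseteq> X\<close> by (auto simp: U_def)
  then have A: "A \<subseteq> (\<Union>a\<in>J. U a)"
    unfolding J(3) by blast
  show thesis
  proof (cases "J = {}")
    \<comment> \<open>An enumeration by naturals requires \<open>J\<close> nonempty; here
      \<open>A\<close> is empty as well, so a constant function does.\<close>
    case True
    then show thesis using A that[of "\<lambda>_. 0"] by (auto simp: lyapunov_function_def)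
  next
    case False
    then have range: "range (from_nat_into J) = J"
      using J(2) by (rule range_from_nat_into)
    define G where "G i = g (from_nat_into J i)" for i
    have ly': "lyapunov_function X \<phi> (G i)" for i
      unfolding G_def using ly J(1) range by blast
    obtain h where "lyapunov_function X \<phi> h"
      and h: "\<And>x t. \<lbrakk>x \<in> X; 0 \<le> t; \<exists>i. G i (\<phi> (x, t)) < G i x\<rbrakk> \<Longrightarrow> h (\<phi> (x, t)) < h x"
      using lyapunov_function_combine[of X \<phi> G, OF \<open>compact X\<close> flow ly'] by blast
    moreover have "h (\<phi> (x, t)) < h x" if x: "x \<in> A" for x
    proof (rule h)
      show "x \<in> X" using x \<open>A \<subseteq> X\<close> by blast
      obtain a where "a \<in> J" "x \<in> U a" using A x by blast
      moreover obtain i where "a = from_nat_into J i"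
        using \<open>a \<in> J\<close> range by blast
      ultimately show "\<exists>i. G i (\<phi> (x, t)) < G i x"
        unfolding U_def G_def by blast
    qed fact
    ultimately show thesis using that by blast
  qed
qed

section \<open>Strong chains and their cost\<close>

lemma strong_chain_mono:
  "is_strong_chain X \<phi> \<epsilon> T x y n xs ts \<Longrightarrow> \<epsilon> \<le> \<delta> \<Longrightarrow> is_strong_chain X \<phi> \<delta> T x y n xs ts"
  by (auto simp: is_strong_chain_def)

lemma strong_chain_pos: "is_strong_chain X \<phi> \<epsilon> T x y n xs ts \<Longrightarrow> 0 < \<epsilon>"
  unfolding is_strong_chain_def by (meson sum_nonneg zero_le_dist le_less_trans)

lemma strong_chain_single:
  assumes "x \<in> X" "T \<le> t" "dist (\<phi> (x, t)) y < \<epsilon>"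
  shows "is_strong_chain X \<phi> \<epsilon> T x y 1 (\<lambda>i. if i = 1 then x else y) (\<lambda>_. t)"
  using assms by (simp add: is_strong_chain_def)

text \<open>Only the last jump involves the endpoint, and the triangle inequality bounds its
  change.\<close>

lemma strong_chain_move_end:
  assumes "is_strong_chain X \<phi> \<epsilon> T x y n xs ts"
  shows "is_strong_chain X \<phi> (\<epsilon> + dist y y') T x y' n (xs(n + 1 := y')) ts"
proof -
  let ?xs = "xs(n + 1 := y')"
  obtain m where m: "n = Suc m"
    using assms by (cases n) (auto simp: is_strong_chain_def)
  have "dist (\<phi> (xs (m + 1), ts (m + 1))) y' \<le> dist (\<phi> (xs (m + 1), ts (m + 1))) y + dist y y'"
    by (rule dist_triangle)
  moreover have "(\<Sum>i=1..m. dist (\<phi> (?xs i, ts i)) (?xs (i + 1))) = (\<Sum>i=1..m. dist (\<phi> (xs i, ts i)) (xs (i + 1)))"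
    by (rule sum.cong) (auto simp: m)
  ultimately show ?thesis
    using assms by (auto simp: is_strong_chain_def m)
qed

text \<open>The added leg starts at the old endpoint and ends exactly where the flow carries it, so
  its jump is zero.\<close>

lemma strong_chain_append:
  assumes "is_strong_chain X \<phi> \<epsilon> T x y n xs ts" "y \<in> X" "T \<le> t"
  shows "is_strong_chain X \<phi> \<epsilon> T x (\<phi> (y, t)) (n + 1) (xs(n + 2 := \<phi> (y, t))) (ts(n + 1 := t))"
proof -
  let ?xs = "xs(n + 2 := \<phi> (y, t))" and ?ts = "ts(n + 1 := t)"
  have "(\<Sum>i=1..n. dist (\<phi> (?xs i, ?ts i)) (?xs (i + 1))) = (\<Sum>i=1..n. dist (\<phi> (xs i, ts i)) (xs (i + 1)))"
    by (rule sum.cong) auto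
  then show ?thesis
    using assms by (auto simp: is_strong_chain_def)
qed

definition chain_cost ::
  "'a::metric_space set \<Rightarrow> ('a \<times> real \<Rightarrow> 'a) \<Rightarrow> real \<Rightarrow> 'a \<Rightarrow> 'a \<Rightarrow> real" where
  "chain_cost X \<phi> T x y = Inf {\<epsilon>. \<exists>n xs ts. is_strong_chain X \<phi> \<epsilon> T x y n xs ts}"

lemma chain_cost_le:
  "is_strong_chain X \<phi> \<epsilon> T x y n xs ts \<Longrightarrow> chain_cost X \<phi> T x y \<le> \<epsilon>"
  unfolding chain_cost_def
  by (rule cInf_lower) (auto intro!: bdd_belowI[of _ 0] dest: strong_chain_pos)

lemma chain_cost_greatest:
  assumes "x \<in> X" and "\<And>\<epsilon> n xs ts. is_strong_chain X \<phi> \<epsilon> T x y n xs ts \<Longrightarrow> c \<le> \<epsilon>"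
  shows "c \<le> chain_cost X \<phi> T x y"
proof -
  \<comment> \<open>A one-leg chain shows that the infimum is over a nonempty set; adding 1 makes
    the inequality strict.\<close>
  have "is_strong_chain X \<phi> (dist (\<phi> (x, T)) y + 1) T x y 1 (\<lambda>i. if i = 1 then x else y) (\<lambda>_. T)"
    using assms(1) by (intro strong_chain_single) auto
  then show ?thesis
    unfolding chain_cost_def by (intro cInf_greatest) (use assms(2) in blast)+
qed

lemma chain_cost_Lipschitz:
  assumes "x \<in> X"
  shows "chain_cost X \<phi> T x y' \<le> chain_cost X \<phi> T x y + dist y y'"
proof -
  have "chain_cost X \<phi> T x y' - dist y y' \<le> chain_cost X \<phi> T x y"
    using assms
  proof (rule chain_cost_greatest)
    fix \<epsilon> n xs ts assume "is_strong_chain X \<phi> \<epsilon> T x y n xs ts"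
    then show "chain_cost X \<phi> T x y' - dist y y' \<le> \<epsilon>"
      using chain_cost_le[OF strong_chain_move_end[where y' = y']] by fastforce
  qed
  then show ?thesis by simp
qed

lemma chain_cost_flow_le:
  assumes "x \<in> X" "y \<in> X" "T \<le> t"
  shows "chain_cost X \<phi> T x (\<phi> (y, t)) \<le> chain_cost X \<phi> T x y"
  using assms(1) by (rule chain_cost_greatest) (rule chain_cost_le, rule strong_chain_append, use assms in auto)

lemma chain_cost_flow_self:
  assumes "x \<in> X" "T \<le> t"
  shows "chain_cost X \<phi> T x (\<phi> (x, t)) \<le> 0"
  by (rule field_le_epsilon) (use chain_cost_le[OF strong_chain_single[OF assms]] in auto)

section \<open>Strict drops off the strong chain recurrent set\<close>

lemma lyapunov_function_drop:
  assumes "compact X" and flow: "continuous_flow X \<phi>"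
    and x: "x \<in> X - strong_chain_recurrent_set X \<phi>"
  obtains h T where "lyapunov_function X \<phi> h" "0 < T" "h (\<phi> (x, T)) < h x"
proof -
  have inX: "\<phi> (y, t) \<in> X" and zero: "\<phi> (y, 0) = y"
    and add: "\<phi> (\<phi> (y, s), t) = \<phi> (y, s + t)" if "y \<in> X" for y s t
    using flow that by (auto simp: continuous_flow_def)
  obtain \<epsilon> T where "\<epsilon> > 0" "T > 0" and no: "\<And>n xs ts. \<not> is_strong_chain X \<phi> \<epsilon> T x x n xs ts"
    and "x \<in> X"
    using x by (auto simp: strong_chain_recurrent_set_def)
  define L where "L = chain_cost X \<phi> T x"
  have Lip: "L z \<le> L y + dist y z" for y z
    unfolding L_def by (rule chain_cost_Lipschitz) fact
  \<comment> \<open>A chain for a value below \<open>\<epsilon>\<close> would also be one for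
    \<open>\<epsilon>\<close>, contradicting \<open>no\<close>.\<close>
  have "\<epsilon> \<le> L x"
    unfolding L_def using \<open>x \<in> X\<close>
    by (rule chain_cost_greatest) (metis no linear strong_chain_mono)
  define h where "h y = (SUP s\<in>{0..T}. L (\<phi> (y, s)))" for y
  have "L z \<le> L x + diameter X" if "z \<in> X" for z
    using Lip[of z x] diameter_bounded_bound[OF compact_imp_bounded[OF \<open>compact X\<close>] \<open>x \<in> X\<close> that]
    by simp
  then have bdd: "bdd_above ((\<lambda>s. L (\<phi> (y, s))) ` {0..T})" if "y \<in> X" for y
    using inX[OF that] by (intro bdd_aboveI2[where M = "L x + diameter X"]) auto
  have upper: "L (\<phi> (y, s)) \<le> h y" if "y \<in> X" "0 \<le> s" "s \<le> T" for y s
    unfolding h_def using bdd that by (intro cSUP_upper) auto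
  have least: "h y \<le> c" if "\<And>s. \<lbrakk>0 \<le> s; s \<le> T\<rbrakk> \<Longrightarrow> L (\<phi> (y, s)) \<le> c" for y c
    unfolding h_def using that \<open>T > 0\<close> by (intro cSUP_least) auto
  have "continuous_on X h"
  proof (rule continuous_onI)
    fix y and e :: real assume "y \<in> X" "0 < e"
    \<comment> \<open>Restricting time to \<open>{0..T}\<close> makes the domain compact, so one
      \<open>d\<close> serves all \<open>s\<close> in the supremum.\<close>
    have "continuous_on (X \<times> {0..T}) \<phi>"
      by (rule continuous_on_subset[of "X \<times> UNIV"]) (use flow in \<open>auto simp: continuous_flow_def\<close>)
    then have "uniformly_continuous_on (X \<times> {0..T}) \<phi>"
      using \<open>compact X\<close> by (intro compact_uniformly_continuous compact_Times) auto
    then obtain d where "d > 0" and d: "\<And>p q. \<lbrakk>p \<in> X \<times> {0..T}; q \<in> X \<times> {0..T}; dist q p < d\<rbrakk>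
        \<Longrightarrow> dist (\<phi> q) (\<phi> p) < e"
      using \<open>0 < e\<close> unfolding uniformly_continuous_on_def by metis
    have le: "h u \<le> h v + e" if "u \<in> X" "v \<in> X" "dist v u < d" for u v
    proof (rule least)
      fix s assume s: "0 \<le> s" "s \<le> T"
      have "dist (\<phi> (v, s)) (\<phi> (u, s)) < e"
        using that s by (intro d) (auto simp: dist_Pair_Pair)
      then show "L (\<phi> (u, s)) \<le> h v + e"
        using Lip[of "\<phi> (u, s)" "\<phi> (v, s)"] upper[OF \<open>v \<in> X\<close> s] by simp
    qed
    show "\<exists>d>0. \<forall>z\<in>X. dist z y < d \<longrightarrow> dist (h z) (h y) \<le> e"
    proof (intro exI conjI ballI impI)
      fix z assume "z \<in> X" "dist z y < d"
      then show "dist (h z) (h y) \<le> e"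
        using le[of y z] le[of z y] \<open>y \<in> X\<close> by (simp add: dist_real_def dist_commute abs_le_iff)
    qed fact
  qed
  moreover have "h (\<phi> (y, t)) \<le> h y" if "y \<in> X" "0 \<le> t" for y t
  proof (rule least)
    fix s assume s: "0 \<le> s" "s \<le> T"
    show "L (\<phi> (\<phi> (y, t), s)) \<le> h y"
    \<comment> \<open>Either the shifted time is still in the window defining \<open>h y\<close>, or
      it exceeds \<open>T\<close> and \<open>L\<close> there is at most \<open>L y\<close>, the
      time-0 entry of the window.\<close>
    proof (cases "t + s \<le> T")
      case True
      then show ?thesis using upper[of y "t + s"] that s by (simp add: add)
    next
      case False
      then have "L (\<phi> (y, t + s)) \<le> L y"
        unfolding L_def using \<open>x \<in> X\<close> that by (intro chain_cost_flow_le) auto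
      then show ?thesis
        using upper[of y 0] that \<open>T > 0\<close> by (simp add: add zero)
    qed
  qed
  ultimately have "lyapunov_function X \<phi> h"
    by (simp add: lyapunov_function_def)
  moreover have "h (\<phi> (x, T)) \<le> 0"
    by (rule least) (use \<open>x \<in> X\<close> in \<open>auto simp: L_def add intro: chain_cost_flow_self\<close>)
  moreover have "L x \<le> h x"
    using upper[of x 0] \<open>x \<in> X\<close> \<open>T > 0\<close> by (simp add: zero)
  ultimately show thesis
    using that \<open>\<epsilon> \<le> L x\<close> \<open>\<epsilon> > 0\<close> \<open>T > 0\<close> by fastforce
qed

text \<open>When the orbit of \<open>x\<close> is cut into steps of length \<open>t\<close>, the
  drop of \<open>h\<close> over time \<open>T\<close> must show in some step \<open>k\<close>;
  shifting \<open>h\<close> by time \<open>real k * t\<close> moves that step to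
  \<open>x\<close>.\<close>

lemma lyapunov_function_strict_at:
  assumes "compact X" and flow: "continuous_flow X \<phi>"
    and x: "x \<in> X - strong_chain_recurrent_set X \<phi>" and "0 < t"
  shows "\<exists>g. lyapunov_function X \<phi> g \<and> g (\<phi> (x, t)) < g x"
proof -
  obtain h T where h: "lyapunov_function X \<phi> h" and "0 < T" and drop: "h (\<phi> (x, T)) < h x"
    using lyapunov_function_drop[OF assms(1-3)] .
  have X: "x \<in> X" using x by blast
  have "\<exists>k. h (\<phi> (\<phi> (x, t), real k * t)) < h (\<phi> (x, real k * t))"
  proof (rule ccontr)
    assume "\<nexists>k. h (\<phi> (\<phi> (x, t), real k * t)) < h (\<phi> (x, real k * t))"
    then have step: "h (\<phi> (x, real k * t)) \<le> h (\<phi> (x, real (Suc k) * t))" for k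
      using flow X by (auto simp: continuous_flow_def algebra_simps not_less)
    have le: "h x \<le> h (\<phi> (x, real k * t))" for k
    proof (induction k)
      case 0
      then show ?case using flow X by (simp add: continuous_flow_def)
    next
      case (Suc k)
      then show ?case using step[of k] by linarith
    qed
    \<comment> \<open>Once a multiple of \<open>t\<close> passes \<open>T\<close>, monotonicity
      bounds \<open>h\<close> there by \<open>h (\<phi> (x, T))\<close>; with \<open>le\<close> this
      contradicts \<open>drop\<close>.\<close>
    obtain k where k: "T < real k * t"
      using reals_Archimedean3[OF \<open>0 < t\<close>] by blast
    have "\<phi> (x, real k * t) = \<phi> (\<phi> (x, T), real k * t - T)"
      using flow X by (simp add: continuous_flow_def)
    moreover have "h (\<phi> (\<phi> (x, T), real k * t - T)) \<le> h (\<phi> (x, T))"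
      using h k flow X unfolding lyapunov_function_def continuous_flow_def
      by (metis diff_ge_0_iff_ge less_imp_le)
    ultimately show False using drop le[of k] by simp
  qed
  then show ?thesis using lyapunov_function_shift[OF flow h] by blast
qed

theorem theorem1p1:
  fixes X :: "'a::metric_space set" and \<phi> :: "'a \<times> real \<Rightarrow> 'a"
  assumes "compact X"
    and "continuous_flow X \<phi>"
  shows "\<exists>h :: 'a \<Rightarrow> real. lyapunov_function X \<phi> h \<and>
           (\<forall>x \<in> X - strong_chain_recurrent_set X \<phi>. \<forall>t>0. h (\<phi> (x, t)) < h x)"
proof -
  let ?A = "X - strong_chain_recurrent_set X \<phi>"
  have "\<exists>g. lyapunov_function X \<phi> g \<and> (\<forall>x\<in>?A. g (\<phi> (x, 1 / real (Suc n))) < g x)" for n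
    by (rule lyapunov_function_strict_on[OF assms, of ?A "1 / real (Suc n)"])
      (use lyapunov_function_strict_at[OF assms] in auto)
  then obtain g where g: "\<And>n. lyapunov_function X \<phi> (g n)"
    and less: "\<And>n x. x \<in> ?A \<Longrightarrow> g n (\<phi> (x, 1 / real (Suc n))) < g n x"
    by metis
  obtain h where h: "lyapunov_function X \<phi> h"
    and strict: "\<And>x t. \<lbrakk>x \<in> X; 0 \<le> t; \<exists>n. g n (\<phi> (x, t)) < g n x\<rbrakk> \<Longrightarrow> h (\<phi> (x, t)) < h x"
    using lyapunov_function_combine[of X \<phi> g, OF assms g] by blast
  have "h (\<phi> (x, t)) < h x" if x: "x \<in> ?A" and t: "0 < t" for x t
  proof (rule strict)
    \<comment> \<open>A drop reached at a time below \<open>t\<close> persists up to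
      \<open>t\<close>, since \<open>g n\<close> does not increase afterwards.\<close>
    obtain n where n: "1 / real (Suc n) < t"
      using nat_approx_posE[OF t] .
    let ?s = "1 / real (Suc n)"
    have "\<phi> (x, t) = \<phi> (\<phi> (x, ?s), t - ?s)" and "\<phi> (x, ?s) \<in> X"
      using assms(2) x by (simp_all add: continuous_flow_def)
    then have "g n (\<phi> (x, t)) \<le> g n (\<phi> (x, ?s))"
      using g[of n] n by (simp add: lyapunov_function_def)
    then show "\<exists>n. g n (\<phi> (x, t)) < g n x"
      using less[OF x] le_less_trans by blast
  qed (use x t in auto)
  with h show ?thesis by blast
qed

end
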